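(* There exist a finitely generated solvable group $G$ of derived length $3$ and a finitely generated subgroup $H\leq G$ such that $H$ does not have bounded packing in $G$.
   Context: Bounded packing: let $G$ be a countable group with a proper left-invariant metric $d$ (proper meaning that all balls are finite; every countable group admits such a metric). For cosets $g_1H,g_2H$ write $d(g_1H,g_2H)=\inf\{d(x,y): x\in g_1H,\ y\in g_2H\}$. A subgroup $H\leq G$ has bounded packing in $G$ if for every $D>0$ there is a number $n=n(G,H,D)$ such that every collection $I$ of distinct left cosets of $H$ in $G$ satisfying $d(g_1H,g_2H)\leq D$ for all $g_1H,g_2H\in I$ has $|I|\leq n$. This property does not depend on the choice of proper left-invariant metric. *)

theory Defs
  imports "HOL-Algebra.Solvable_Groups" "HOL-Algebra.Left_Coset"
    "HOL-Analysis.Abstract_Metric_Spaces" "HOL-Library.Countable_Set"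
begin

definition finitely_generated :: "('a, 'b) monoid_scheme \<Rightarrow> 'a set \<Rightarrow> bool" where
  "finitely_generated G H \<longleftrightarrow> (\<exists>S. finite S \<and> S \<subseteq> H \<and> generate G S = H)"

text \<open>Only meaningful for solvable groups; otherwise the \<open>LEAST\<close> is unspecified.\<close>

definition derived_length :: "('a, 'b) monoid_scheme \<Rightarrow> nat" where
  "derived_length G = (LEAST n. (derived G ^^ n) (carrier G) = {\<one>\<^bsub>G\<^esub>})"

definition proper_left_invariant_metric ::
    "('a, 'b) monoid_scheme \<Rightarrow> ('a \<Rightarrow> 'a \<Rightarrow> real) \<Rightarrow> bool" where
  "proper_left_invariant_metric G d \<longleftrightarrow>
     Metric_space (carrier G) d \<and>
     (\<forall>g\<in>carrier G. \<forall>x\<in>carrier G. \<forall>y\<in>carrier G.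
        d (g \<otimes>\<^bsub>G\<^esub> x) (g \<otimes>\<^bsub>G\<^esub> y) = d x y) \<and>
     (\<forall>x\<in>carrier G. \<forall>r. finite (Metric_space.mcball (carrier G) d x r))"

definition set_dist :: "('a \<Rightarrow> 'a \<Rightarrow> real) \<Rightarrow> 'a set \<Rightarrow> 'a set \<Rightarrow> real" where
  "set_dist d A B = Inf {d x y | x y. x \<in> A \<and> y \<in> B}"

definition bounded_packing_wrt ::
    "('a \<Rightarrow> 'a \<Rightarrow> real) \<Rightarrow> ('a, 'b) monoid_scheme \<Rightarrow> 'a set \<Rightarrow> bool" where
  "bounded_packing_wrt d G H \<longleftrightarrow>
     (\<forall>D>0. \<exists>n::nat. \<forall>I \<subseteq> lcosets\<^bsub>G\<^esub> H.
        (\<forall>A\<in>I. \<forall>B\<in>I. set_dist d A B \<le> D) \<longrightarrow> finite I \<and> card I \<le> n)"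

text \<open>
  The choice of the metric is immaterial: on a countable group a proper left-invariant
  metric exists, and any two such metrics give the same notion
  (lemmas \<open>proper_left_invariant_metric_exists\<close> and \<open>bounded_packing_iff\<close> below).
  In particular, failure of bounded packing in the sense below is failure with respect
  to every such metric.
\<close>

definition bounded_packing :: "('a, 'b) monoid_scheme \<Rightarrow> 'a set \<Rightarrow> bool" where
  "bounded_packing G H \<longleftrightarrow>
     (\<forall>d. proper_left_invariant_metric G d \<longrightarrow> bounded_packing_wrt d G H)"

lemma bounded_packing_wrt_indep:
  fixes G (structure)
  assumes G: "group G" and H: "subgroup H G"
    and d: "proper_left_invariant_metric G d" and e: "proper_left_invariant_metric G e"
    and bp: "bounded_packing_wrt d G H"
  shows "bounded_packing_wrt e G H"
  unfolding bounded_packing_wrt_def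
proof (intro allI impI)
  interpret group G by (fact G)
  fix D :: real assume "0 < D"
  have Md: "Metric_space (carrier G) d" and Me: "Metric_space (carrier G) e"
    using d e by (auto simp: proper_left_invariant_metric_def)
  let ?B = "Metric_space.mcball (carrier G) e \<one> (D + 1)"
  have fin: "finite ?B"
    using e by (simp add: proper_left_invariant_metric_def)
  define C where "C = Max (insert 1 (d \<one> ` ?B))"
  have C1: "1 \<le> C" unfolding C_def using fin by simp
  have C: "d \<one> z \<le> C" if "z \<in> carrier G" "e \<one> z \<le> D + 1" for z
    unfolding C_def using fin that
    by (intro Max_ge) (auto simp: Metric_space.in_mcball[OF Me])
  have "C > 0" using C1 by simp
  then obtain n where n: "\<And>I. I \<subseteq> lcosets H \<Longrightarrow>
      (\<forall>A\<in>I. \<forall>B\<in>I. set_dist d A B \<le> C) \<Longrightarrow> finite I \<and> card I \<le> n"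
    using bp unfolding bounded_packing_wrt_def by blast
  have le: "set_dist d A B \<le> C"
    if A: "A \<in> lcosets H" and B: "B \<in> lcosets H" and AB: "set_dist e A B \<le> D" for A B
  proof -
    have sub: "A \<subseteq> carrier G" "B \<subseteq> carrier G"
      using A B subgroup.lcosets_carrier[OF H G] by auto
    have ne: "A \<noteq> {}" "B \<noteq> {}"
      using A B subgroup.one_closed[OF H] by (auto simp: LCOSETS_def l_coset_def)
    have "Inf {e x y |x y. x \<in> A \<and> y \<in> B} < D + 1"
      using AB by (simp add: set_dist_def)
    moreover have "{e x y |x y. x \<in> A \<and> y \<in> B} \<noteq> {}" using ne by blast
    ultimately have "\<exists>z\<in>{e x y |x y. x \<in> A \<and> y \<in> B}. z < D + 1"
      by (intro cInf_lessD)
    then obtain x y where xy: "x \<in> A" "y \<in> B" "e x y < D + 1" by blast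
    have xyG: "x \<in> carrier G" "y \<in> carrier G" using xy sub by auto
    have inv: "f x y = f \<one> (inv x \<otimes> y)" if "proper_left_invariant_metric G f" for f
    proof -
      have "f (inv x \<otimes> x) (inv x \<otimes> y) = f x y"
        using that xyG unfolding proper_left_invariant_metric_def by blast
      then show ?thesis using xyG by simp
    qed
    have "d x y \<le> C"
      using C[of "inv x \<otimes> y"] inv[OF d] inv[OF e] xy(3) xyG by simp
    moreover have "set_dist d A B \<le> d x y"
      unfolding set_dist_def
      by (intro cInf_lower) (use xy in \<open>auto intro!: bdd_belowI[of _ 0] simp: Metric_space.nonneg[OF Md]\<close>)
    ultimately show ?thesis by linarith
  qed
  show "\<exists>n::nat. \<forall>I \<subseteq> lcosets H.
        (\<forall>A\<in>I. \<forall>B\<in>I. set_dist e A B \<le> D) \<longrightarrow> finite I \<and> card I \<le> n"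
  proof (intro exI[of _ n] allI impI)
    fix I assume "I \<subseteq> lcosets H" "\<forall>A\<in>I. \<forall>B\<in>I. set_dist e A B \<le> D"
    then show "finite I \<and> card I \<le> n"
      using le by (intro n) (auto simp: subset_iff)
  qed
qed

lemma bounded_packing_iff:
  assumes "group G" "subgroup H G" "proper_left_invariant_metric G d"
  shows "bounded_packing G H \<longleftrightarrow> bounded_packing_wrt d G H"
  using assms bounded_packing_wrt_indep unfolding bounded_packing_def by blast

lemma proper_left_invariant_metric_exists:
  fixes G (structure)
  assumes G: "group G" and cnt: "countable (carrier G)"
  shows "\<exists>d. proper_left_invariant_metric G d"
proof -
  interpret group G by (fact G)
  obtain f :: "'a \<Rightarrow> nat" where f: "inj_on f (carrier G)"
    using cnt by (auto simp: countable_def)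
  define w where "w g = f g + f (inv g) + 1" for g
  define P where "P xs = foldr (\<otimes>) xs \<one>" for xs
  define L where "L g = (LEAST n. \<exists>xs. set xs \<subseteq> carrier G \<and> P xs = g \<and> sum_list (map w xs) = n)" for g
  have P_closed: "P xs \<in> carrier G" if "set xs \<subseteq> carrier G" for xs
    using that by (induction xs) (auto simp: P_def)
  have P_append: "P (xs @ ys) = P xs \<otimes> P ys"
    if "set xs \<subseteq> carrier G" "set ys \<subseteq> carrier G" for xs ys
    using that
  proof (induction xs)
    case Nil then show ?case using P_closed[of ys] by (simp add: P_def)
  next
    case (Cons a xs)
    have "P (a # xs @ ys) = a \<otimes> P (xs @ ys)" "P (a # xs) = a \<otimes> P xs" by (auto simp: P_def)
    then show ?case using Cons P_closed[of ys] P_closed[of xs] by (simp add: m_assoc)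
  qed
  have L_le: "L (P xs) \<le> sum_list (map w xs)" if "set xs \<subseteq> carrier G" for xs
    unfolding L_def by (rule Least_le) (use that in blast)
  have L_ex: "\<exists>xs. set xs \<subseteq> carrier G \<and> P xs = g \<and> sum_list (map w xs) = L g"
    if "g \<in> carrier G" for g
  proof -
    have "\<exists>n xs. set xs \<subseteq> carrier G \<and> P xs = g \<and> sum_list (map w xs) = n"
      using that by (intro exI[of _ "w g"] exI[of _ "[g]"]) (auto simp: P_def)
    then show ?thesis unfolding L_def by (rule LeastI_ex)
  qed
  have L_mult: "L (g \<otimes> h) \<le> L g + L h" if gh: "g \<in> carrier G" "h \<in> carrier G" for g h
  proof -
    obtain xs where "set xs \<subseteq> carrier G" "P xs = g" "sum_list (map w xs) = L g"
      using L_ex[OF gh(1)] by blast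
    moreover obtain ys where "set ys \<subseteq> carrier G" "P ys = h" "sum_list (map w ys) = L h"
      using L_ex[OF gh(2)] by blast
    ultimately show ?thesis using L_le[of "xs @ ys"] P_append[of xs ys] by simp
  qed
  have P_inv: "P (rev (map (m_inv G) xs)) = inv (P xs)" if "set xs \<subseteq> carrier G" for xs
    using that
  proof (induction xs)
    case Nil then show ?case by (simp add: P_def)
  next
    case (Cons a xs)
    have "P (rev (map (m_inv G) (a # xs))) = P (rev (map (m_inv G) xs)) \<otimes> P [inv a]"
      using Cons.prems by (simp, subst P_append) auto
    moreover have "P (a # xs) = a \<otimes> P xs" "P [inv a] = inv a"
      using Cons.prems by (auto simp: P_def)
    ultimately show ?case using Cons P_closed[of xs] by (simp add: inv_mult_group)
  qed
  have L_inv_le: "L (inv g) \<le> L g" if g: "g \<in> carrier G" for g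
  proof -
    obtain xs where xs: "set xs \<subseteq> carrier G" "P xs = g" "sum_list (map w xs) = L g"
      using L_ex[OF g] by blast
    have "map (w \<circ> m_inv G) xs = map w xs"
      using xs(1) by (auto simp: w_def)
    then have "sum_list (map w (rev (map (m_inv G) xs))) = L g"
      using xs(3) by (simp only: rev_map[symmetric] sum_list_rev map_map)
    then show ?thesis using L_le[of "rev (map (m_inv G) xs)"] P_inv[OF xs(1)] xs(1,2) by auto
  qed
  have L_inv: "L (inv g) = L g" if "g \<in> carrier G" for g
    using L_inv_le[OF that] L_inv_le[of "inv g"] that by simp
  have len: "length xs \<le> sum_list (map w xs)" for xs
    by (induction xs) (auto simp: w_def)
  have L_zero: "L g = 0 \<longleftrightarrow> g = \<one>" if g: "g \<in> carrier G" for g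
  proof
    assume "L g = 0"
    then obtain xs where "P xs = g" "sum_list (map w xs) = 0" using L_ex[OF g] by auto
    moreover from this have "xs = []" using len[of xs] by (simp del: sum_list_eq_0_iff)
    ultimately show "g = \<one>" by (simp add: P_def)
  next
    assume "g = \<one>"
    then show "L g = 0" using L_le[of "[]"] by (simp add: P_def)
  qed
  have L_fin: "finite {g \<in> carrier G. L g \<le> n}" for n
  proof -
    let ?W = "{g \<in> carrier G. w g \<le> n}"
    have "finite ?W"
    proof (rule inj_on_finite[of f _ "{..n}"])
      show "inj_on f ?W" using f by (rule inj_on_subset) auto
    qed (auto simp: w_def)
    then have "finite (P ` {xs. set xs \<subseteq> ?W \<and> length xs \<le> n})"
      by (intro finite_imageI finite_lists_length_le)
    moreover have "{g \<in> carrier G. L g \<le> n} \<subseteq> P ` {xs. set xs \<subseteq> ?W \<and> length xs \<le> n}"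
    proof clarify
      fix g assume g: "g \<in> carrier G" and Lg: "L g \<le> n"
      obtain xs where xs: "set xs \<subseteq> carrier G" "P xs = g" "sum_list (map w xs) = L g"
        using L_ex[OF g] by blast
      have "w x \<le> n" if "x \<in> set xs" for x
        using member_le_sum_list[of "w x" "map w xs"] that xs(3) Lg by simp
      then show "g \<in> P ` {xs. set xs \<subseteq> ?W \<and> length xs \<le> n}"
        using xs len[of xs] Lg by (intro image_eqI[of _ _ xs]) auto
    qed
    ultimately show ?thesis by (rule rev_finite_subset)
  qed
  define d where "d x y = (if x \<in> carrier G \<and> y \<in> carrier G then real (L (inv x \<otimes> y)) else 0)" for x y
  have M: "Metric_space (carrier G) d"
  proof
    show "0 \<le> d x y" for x y by (simp add: d_def)
    show "d x y = d y x" for x y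
      using L_inv[of "inv x \<otimes> y"]
      by (cases "x \<in> carrier G \<and> y \<in> carrier G") (auto simp: d_def inv_mult_group)
    show "d x y = 0 \<longleftrightarrow> x = y" if xy: "x \<in> carrier G" "y \<in> carrier G" for x y
    proof -
      have "inv x \<otimes> y = \<one> \<longleftrightarrow> x = y"
        using xy inv_solve_left'[of \<one> x y] by auto
      then show ?thesis using xy L_zero[of "inv x \<otimes> y"] by (simp add: d_def)
    qed
    show "d x z \<le> d x y + d y z"
      if xyz: "x \<in> carrier G" "y \<in> carrier G" "z \<in> carrier G" for x y z
    proof -
      have "y \<otimes> (inv y \<otimes> z) = z" using xyz by (simp flip: m_assoc)
      then have "(inv x \<otimes> y) \<otimes> (inv y \<otimes> z) = inv x \<otimes> z"
        using xyz by (simp add: m_assoc)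
      then show ?thesis using L_mult[of "inv x \<otimes> y" "inv y \<otimes> z"] xyz by (simp add: d_def)
    qed
  qed
  have "d (g \<otimes> x) (g \<otimes> y) = d x y"
    if gxy: "g \<in> carrier G" "x \<in> carrier G" "y \<in> carrier G" for g x y
  proof -
    have "inv (g \<otimes> x) \<otimes> (g \<otimes> y) = inv x \<otimes> y"
      using gxy by (simp add: inv_mult_group m_assoc) (simp flip: m_assoc)
    then show ?thesis using gxy by (simp add: d_def)
  qed
  moreover have "finite (Metric_space.mcball (carrier G) d x r)" if x: "x \<in> carrier G" for x r
  proof -
    have "Metric_space.mcball (carrier G) d x r \<subseteq> (\<lambda>g. x \<otimes> g) ` {g \<in> carrier G. L g \<le> nat \<lfloor>r\<rfloor>}"
    proof
      fix y assume "y \<in> Metric_space.mcball (carrier G) d x r"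
      then have y: "y \<in> carrier G" "d x y \<le> r" by (auto simp: Metric_space.in_mcball[OF M])
      have "L (inv x \<otimes> y) \<le> nat \<lfloor>r\<rfloor>" using y x by (simp add: d_def le_nat_floor)
      moreover have "y = x \<otimes> (inv x \<otimes> y)" using x y by (simp flip: m_assoc)
      ultimately show "y \<in> (\<lambda>g. x \<otimes> g) ` {g \<in> carrier G. L g \<le> nat \<lfloor>r\<rfloor>}"
        using x y by blast
    qed
    then show ?thesis using L_fin finite_surj by blast
  qed
  ultimately have "proper_left_invariant_metric G d"
    using M unfolding proper_left_invariant_metric_def by blast
  then show ?thesis by blast
qed

end

theory Submission
  imports Defs "HOL-Algebra.Weak_Morphisms"
begin

text \<open>
  The group \<open>G\<close> acts on countably many rational lines \<open>\<int> \<times> \<rat>\<close>. It is generated by three maps: the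
  shift \<open>t\<close> that carries each line to the next one, the map \<open>a\<close> that multiplies the line with
  index \<open>k\<close> by the positive integer \<open>\<bar>k\<bar> + 1\<close>, and the map \<open>f\<close> that translates the line \<open>0\<close> by \<open>1\<close>
  and fixes all the other lines. The subgroup is \<open>H = \<langle>t, a\<rangle>\<close>.

  Conjugating \<open>a\<close> by a power of \<open>t\<close> moves the factors along the lines, so for every positive
  integer \<open>n\<close> some element of \<open>H\<close> preserves each line and multiplies the line \<open>0\<close> by \<open>n\<close>.
  Conjugating \<open>f\<close> by it gives \<open>f\<^sup>n\<close>. Hence all powers \<open>f\<^sup>n\<close> lie in
  \<open>H f H \<union> H \<union> H f\<inverse> H\<close> (lemma \<open>translation_difference\<close>), which says that the cosets \<open>f\<^sup>n H\<close> are
  pairwise within a bounded distance. They are pairwise distinct because \<open>H\<close> preserves the set of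
  origins of the lines, which \<open>f\<^sup>n\<close> does not for \<open>n \<noteq> 0\<close>. Infinitely many pairwise close
  cosets contradict bounded packing (lemma \<open>not_bounded_packing_if_differences_in_finite_double_cosets\<close>).

  The group \<open>G\<close> sits inside the group \<open>fibre_affine\<close> of all bijections of \<open>\<int> \<times> \<rat>\<close> that shift the
  index and are affine on each line. Its commutators preserve each line, second commutators are
  moreover translations on each line, and those commute; so the derived length is at most \<open>3\<close>.
  It is not smaller for \<open>G\<close>: the commutator of \<open>a\<close> and \<open>t\<close> scales the line \<open>0\<close> by \<open>1/2\<close>, some
  commutator is the translation \<open>f\<close>, and these two do not commute (lemma
  \<open>derived2_nontrivial\<close>). The group \<open>G\<close> is described by its generators alone, as
  \<open>generate\<close> in \<open>fibre_affine\<close>; being countable, it is isomorphic to a group on a set of natural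
  numbers (lemma \<open>generate_embeds_in_nat\<close>).
\<close>

section \<open>Countable groups, derived length and packing\<close>

text \<open>The generated set is exhausted by countable stages, each adding the products of pairs from
  the previous one.\<close>

lemma countable_generate:
  assumes "countable S"
  shows "countable (generate G S)"
proof -
  define C where "C = rec_nat (insert \<one>\<^bsub>G\<^esub> (S \<union> m_inv G ` S))
    (\<lambda>_ A. A \<union> (\<lambda>(x, y). x \<otimes>\<^bsub>G\<^esub> y) ` (A \<times> A))"
  have C_Suc: "C (Suc n) = C n \<union> (\<lambda>(x, y). x \<otimes>\<^bsub>G\<^esub> y) ` (C n \<times> C n)" for n
    by (simp add: C_def)
  have "mono C"
    by (intro mono_iff_le_Suc[THEN iffD2]) (simp add: C_Suc)
  have "generate G S \<subseteq> (\<Union>n. C n)"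
  proof
    fix x assume "x \<in> generate G S"
    then show "x \<in> (\<Union>n. C n)"
    proof induction
      case (eng x y)
      then obtain i j where "x \<in> C i" "y \<in> C j" by blast
      then have "x \<in> C (max i j)" "y \<in> C (max i j)"
        using \<open>mono C\<close> by (meson max.cobounded1 max.cobounded2 monoD subsetD)+
      then have "x \<otimes>\<^bsub>G\<^esub> y \<in> C (Suc (max i j))" by (auto simp: C_Suc)
      then show ?case by blast
    qed (auto simp: C_def intro!: exI[of _ 0])
  qed
  moreover have "countable (C n)" for n
    by (induction n) (use assms in \<open>auto simp: C_def\<close>)
  ultimately show ?thesis
    by (meson countable_UN countable_subset countableI_type)
qed

text \<open>If \<open>x\<inverse> y = h c h'\<close>, then \<open>x h \<in> x H\<close> and \<open>y h'\<inverse> = x h c \<in> y H\<close> are at distance \<open>d(1, c)\<close> by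
  left invariance, and this is bounded over the finite set \<open>F\<close>.\<close>

lemma (in group) not_bounded_packing_if_differences_in_finite_double_cosets:
  assumes count: "countable (carrier G)" and H: "subgroup H G"
    and F: "finite F" "F \<subseteq> carrier G"
    and X: "infinite X" "X \<subseteq> carrier G"
    and distinct: "\<And>x y. \<lbrakk>x \<in> X; y \<in> X; inv x \<otimes> y \<in> H\<rbrakk> \<Longrightarrow> x = y"
    and close: "\<And>x y. \<lbrakk>x \<in> X; y \<in> X\<rbrakk> \<Longrightarrow> \<exists>h\<in>H. \<exists>c\<in>F. \<exists>h'\<in>H. inv x \<otimes> y = h \<otimes> c \<otimes> h'"
  shows "\<not> bounded_packing G H"
proof
  assume "bounded_packing G H"
  moreover obtain d where d: "proper_left_invariant_metric G d"
    using proper_left_invariant_metric_exists[OF group_axioms count] by blast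
  ultimately have bp: "bounded_packing_wrt d G H"
    by (simp add: bounded_packing_def)
  have M: "Metric_space (carrier G) d"
    and inv_d: "\<And>g x y. \<lbrakk>g \<in> carrier G; x \<in> carrier G; y \<in> carrier G\<rbrakk> \<Longrightarrow> d (g \<otimes> x) (g \<otimes> y) = d x y"
    using d by (auto simp: proper_left_invariant_metric_def)
  have HG: "H \<subseteq> carrier G" by (rule subgroup.subset[OF H])
  define D where "D = Max (insert 1 (d \<one> ` F))"
  have D: "0 < D" "\<And>c. c \<in> F \<Longrightarrow> d \<one> c \<le> D"
  proof -
    have "1 \<le> D" unfolding D_def using F by simp
    then show "0 < D" by simp
  qed (use F in \<open>auto simp: D_def\<close>)
  let ?I = "(\<lambda>x. x <# H) ` X"
  have "?I \<subseteq> lcosets H"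
    using X by (auto simp: LCOSETS_def)
  moreover have "set_dist d (x <# H) (y <# H) \<le> D" if xy: "x \<in> X" "y \<in> X" for x y
  proof -
    obtain h c h' where h: "h \<in> H" "c \<in> F" "h' \<in> H" and eq: "inv x \<otimes> y = h \<otimes> c \<otimes> h'"
      using close[OF xy] by blast
    have G: "x \<in> carrier G" "y \<in> carrier G" "h \<in> carrier G" "c \<in> carrier G" "h' \<in> carrier G"
      using xy h X F HG by auto
    have "y = x \<otimes> (h \<otimes> c \<otimes> h')"
      using G by (simp flip: eq m_assoc)
    then have "y \<otimes> inv h' = x \<otimes> h \<otimes> c"
      using G by (simp add: m_assoc)
    moreover have "d (x \<otimes> h \<otimes> \<one>) (x \<otimes> h \<otimes> c) = d \<one> c"
      using G by (intro inv_d) auto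
    ultimately have "d (x \<otimes> h) (y \<otimes> inv h') \<le> D"
      using D(2)[OF h(2)] G by simp
    moreover have "x \<otimes> h \<in> x <# H" "y \<otimes> inv h' \<in> y <# H"
      using h subgroup.m_inv_closed[OF H] by (auto simp: l_coset_def)
    ultimately show ?thesis
      unfolding set_dist_def
      by (intro order_trans[OF cInf_lower])
         (auto intro!: bdd_belowI[of _ 0] simp: Metric_space.nonneg[OF M])
  qed
  then have "\<forall>A\<in>?I. \<forall>B\<in>?I. set_dist d A B \<le> D" by simp
  moreover obtain n :: nat where "\<And>I. \<lbrakk>I \<subseteq> lcosets H; \<forall>A\<in>I. \<forall>B\<in>I. set_dist d A B \<le> D\<rbrakk>
      \<Longrightarrow> finite I \<and> card I \<le> n"
    using bp D(1) unfolding bounded_packing_wrt_def by meson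
  ultimately have "finite ?I" by blast
  moreover have "inj_on (\<lambda>x. x <# H) X"
  proof (rule inj_onI)
    fix x y assume xy: "x \<in> X" "y \<in> X" "x <# H = y <# H"
    have "x \<in> carrier G" "y \<in> carrier G"
      using xy X by auto
    then have "inv x \<otimes> y \<in> H"
      using lcos_self[OF _ H, of y] xy(3)
      by (intro subgroup.lcos_module_imp[OF H group_axioms]) simp_all
    then show "x = y"
      using xy distinct by blast
  qed
  ultimately show False
    using X(1) finite_imageD by blast
qed

text \<open>The derived series decreases, so it cannot become trivial before a nontrivial term.\<close>

lemma (in group) derived_length_eq_Suc:
  assumes "(derived G ^^ Suc n) (carrier G) = {\<one>}" "\<not> (derived G ^^ n) (carrier G) \<subseteq> {\<one>}"
  shows "derived_length G = Suc n"
  unfolding derived_length_def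
proof (rule Least_equality)
  fix k assume k: "(derived G ^^ k) (carrier G) = {\<one>}"
  show "Suc n \<le> k"
  proof (rule ccontr)
    assume "\<not> Suc n \<le> k"
    then have "(derived G ^^ n) (carrier G) = (derived G ^^ k) ((derived G ^^ (n - k)) (carrier G))"
      using funpow_add[of k "n - k" "derived G"] by simp
    also have "\<dots> \<subseteq> (derived G ^^ k) (carrier G)"
      by (intro mono_exp_of_derived exp_of_derived_in_carrier) simp
    finally show False using k assms(2) by simp
  qed
qed (fact assms(1))

text \<open>Homomorphisms commute with \<open>generate\<close> and \<open>derived\<close>, so the properties of a countably generated
  subgroup of a group of any type can be read off for its copy \<open>N\<close> on natural numbers.\<close>

lemma (in group) generate_embeds_in_nat:
  assumes "countable S" "S \<subseteq> carrier G"
  obtains N :: "nat monoid" and \<psi> where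
    "group_hom N G \<psi>" "inj_on \<psi> (carrier N)" "\<psi> ` carrier N = generate G S"
proof -
  let ?K = "G\<lparr>carrier := generate G S\<rparr>"
  let ?e = "to_nat_on (generate G S)"
  have sub: "subgroup (generate G S) G"
    using assms by (simp add: generate_is_subgroup)
  interpret K: group ?K
    using sub by (rule subgroup_imp_group)
  have inj: "inj_on ?e (carrier ?K)"
    using inj_on_to_nat_on[OF countable_generate[OF assms(1), of G]] by simp
  let ?N = "image_group ?e ?K"
  have N: "group ?N"
    by (rule K.inj_imp_image_group_is_group[OF inj])
  have "inv_into (generate G S) ?e \<in> iso ?N ?K"
    using K.iso_set_sym inj_imp_image_group_iso[OF inj] by fastforce
  then have iso: "inv_into (generate G S) ?e \<in> hom ?N ?K"
    "bij_betw (inv_into (generate G S) ?e) (carrier ?N) (generate G S)"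
    by (auto simp: iso_def)
  have "group_hom ?N G (inv_into (generate G S) ?e)"
    using iso(1) subgroup.subset[OF sub] N group_axioms
    by (auto simp: group_hom_def group_hom_axioms_def hom_def Pi_iff)
  then show ?thesis
    using iso(2) that[of ?N] by (auto simp: bij_betw_def)
qed

section \<open>Fibrewise affine bijections of countably many rational lines\<close>

text \<open>The triple \<open>(s, m, b)\<close> stands for the bijection \<open>(k, x) \<mapsto> (k + s, m k * x + b k)\<close> of \<open>\<int> \<times> \<rat>\<close>,
  and the product is composition, the right factor being applied first.\<close>

definition fibre_affine :: "(int \<times> (int \<Rightarrow> rat) \<times> (int \<Rightarrow> rat)) monoid" where
  "fibre_affine =
     \<lparr>carrier = {(s, m, b). \<forall>k. m k \<noteq> 0},
      mult = (\<lambda>(s, m, b) (s', m', b').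
        (s + s', \<lambda>k. m (k + s') * m' k, \<lambda>k. m (k + s') * b' k + b (k + s'))),
      one = (0, \<lambda>_. 1, \<lambda>_. 0)\<rparr>"

lemma fibre_affine_simps [simp]:
  "(s, m, b) \<in> carrier fibre_affine \<longleftrightarrow> (\<forall>k. m k \<noteq> 0)"
  "(s, m, b) \<otimes>\<^bsub>fibre_affine\<^esub> (s', m', b') =
     (s + s', \<lambda>k. m (k + s') * m' k, \<lambda>k. m (k + s') * b' k + b (k + s'))"
  "\<one>\<^bsub>fibre_affine\<^esub> = (0, \<lambda>_. 1, \<lambda>_. 0)"
  by (simp_all add: fibre_affine_def)

interpretation W: group fibre_affine
proof (rule groupI)
  fix x assume "x \<in> carrier fibre_affine"
  moreover obtain s m b where x: "x = (s, m, b)" by (cases x)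
  ultimately show "\<exists>y\<in>carrier fibre_affine. y \<otimes>\<^bsub>fibre_affine\<^esub> x = \<one>\<^bsub>fibre_affine\<^esub>"
    by (intro bexI[of _ "(- s, \<lambda>k. 1 / m (k - s), \<lambda>k. - b (k - s) / m (k - s))"])
       (auto simp: field_simps)
qed (auto simp: fibre_affine_def algebra_simps)

lemma inv_fibre_affine [simp]:
  assumes "\<forall>k. m k \<noteq> 0"
  shows "inv\<^bsub>fibre_affine\<^esub> (s, m, b) = (- s, \<lambda>k. 1 / m (k - s), \<lambda>k. - b (k - s) / m (k - s))"
  using assms by (intro W.inv_equality) auto

text \<open>The series consisting of the whole group, the maps preserving each line, the translations on
  each line, and the trivial group has abelian factors.\<close>

lemma derived3_fibre_affine:
  "(derived fibre_affine ^^ 3) (carrier fibre_affine) = {\<one>\<^bsub>fibre_affine\<^esub>}"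
proof -
  let ?D = "derived fibre_affine"
  let ?T1 = "{(s, m, b) \<in> carrier fibre_affine. s = 0}"
  let ?T2 = "{(s, m, b) \<in> carrier fibre_affine. s = 0 \<and> m = (\<lambda>_. 1)}"
  have sub: "subgroup ?T1 fibre_affine" "subgroup ?T2 fibre_affine"
    by (unfold_locales; auto)+
  have 1: "?D (carrier fibre_affine) \<subseteq> ?T1"
    unfolding derived_def by (intro W.generate_subgroup_incl sub) auto
  have 2: "?D ?T1 \<subseteq> ?T2"
    unfolding derived_def by (intro W.generate_subgroup_incl sub) auto
  have 3: "?D ?T2 \<subseteq> {\<one>\<^bsub>fibre_affine\<^esub>}"
    unfolding derived_def by (intro W.generate_subgroup_incl W.triv_subgroup) auto
  have "?D (?D (?D (carrier fibre_affine))) \<subseteq> {\<one>\<^bsub>fibre_affine\<^esub>}"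
    using W.mono_derived[OF W.mono_derived[OF 1]] W.mono_derived[OF 2] 3 by blast
  moreover have "subgroup ((?D ^^ 3) (carrier fibre_affine)) fibre_affine"
    by (intro W.exp_of_derived_is_subgroup W.subgroup_self)
  ultimately show ?thesis
    using subgroup.one_closed by (fastforce simp: eval_nat_numeral)
qed

section \<open>The generators and their linear part\<close>

definition shift :: "int \<Rightarrow> int \<times> (int \<Rightarrow> rat) \<times> (int \<Rightarrow> rat)" where
  "shift s = (s, \<lambda>_. 1, \<lambda>_. 0)"

text \<open>The factors \<open>\<bar>k\<bar> + 1\<close> run through all positive integers, already for \<open>k \<ge> 0\<close>, and this is what
  makes every \<open>translation n\<close> with a positive integer \<open>n\<close> a conjugate of \<open>translation 1\<close>. In
  general \<open>scaling i\<close> is the conjugate of \<open>scaling 0\<close> whose factor on the line \<open>0\<close> is \<open>\<bar>i\<bar> + 1\<close>.\<close>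

definition scaling :: "int \<Rightarrow> int \<times> (int \<Rightarrow> rat) \<times> (int \<Rightarrow> rat)" where
  "scaling i = (0, \<lambda>k. of_int (\<bar>k + i\<bar> + 1), \<lambda>_. 0)"

definition translation :: "rat \<Rightarrow> int \<times> (int \<Rightarrow> rat) \<times> (int \<Rightarrow> rat)" where
  "translation q = (0, \<lambda>_. 1, \<lambda>k. if k = 0 then q else 0)"

abbreviation linear_part :: "(int \<times> (int \<Rightarrow> rat) \<times> (int \<Rightarrow> rat)) set" where
  "linear_part \<equiv> generate fibre_affine {shift 1, scaling 0}"

lemma abs_add_one_nonzero [simp]: "\<bar>x\<bar> + 1 \<noteq> (0 :: 'a :: linordered_idom)"
  by (metis abs_ge_zero add_nonneg_pos less_irrefl zero_less_one)

lemma generators_closed [simp]: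
  "shift s \<in> carrier fibre_affine" "scaling i \<in> carrier fibre_affine"
  "translation q \<in> carrier fibre_affine"
  by (simp_all add: shift_def scaling_def translation_def)

lemma translation_eq_iff: "translation p = translation q \<longleftrightarrow> p = q"
  by (auto simp: translation_def fun_eq_iff split: if_splits)

lemma inv_translation: "inv\<^bsub>fibre_affine\<^esub> (translation q) = translation (- q)"
  by (auto simp: translation_def)

lemma mult_translation:
  "translation p \<otimes>\<^bsub>fibre_affine\<^esub> translation q = translation (p + q)"
  by (auto simp: translation_def)

lemma translation_0: "translation 0 = \<one>\<^bsub>fibre_affine\<^esub>"
  by (auto simp: translation_def)

lemma linear_part_subgroup: "subgroup linear_part fibre_affine"
  by (rule W.generate_is_subgroup) simp

text \<open>Both generators preserve the set of origins \<open>(k, 0)\<close>, hence so does \<open>linear_part\<close>.\<close>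

lemma translation_in_linear_part_iff: "translation q \<in> linear_part \<longleftrightarrow> q = 0"
proof
  let ?L = "{(s, m, b) \<in> carrier fibre_affine. b = (\<lambda>_. 0)}"
  have "subgroup ?L fibre_affine"
    by unfold_locales auto
  then have "linear_part \<subseteq> ?L"
    by (intro W.generate_subgroup_incl) (auto simp: shift_def scaling_def)
  moreover assume "translation q \<in> linear_part"
  ultimately show "q = 0"
    by (auto simp: translation_def fun_eq_iff split: if_splits)
next
  assume "q = 0"
  then show "translation q \<in> linear_part"
    by (metis generate.one translation_0)
qed

lemma scaling_in_linear_part: "scaling (int n) \<in> linear_part"
proof -
  have shift: "shift (int n) \<in> linear_part" for n
  proof (induction n)
    case 0
    have "shift 0 = \<one>\<^bsub>fibre_affine\<^esub>" by (simp add: shift_def)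
    then show ?case by (metis generate.one of_nat_0)
  next
    case (Suc n)
    have "shift (int (Suc n)) = shift (int n) \<otimes>\<^bsub>fibre_affine\<^esub> shift 1"
      by (simp add: shift_def)
    then show ?case using Suc by (metis generate.eng generate.incl insertI1)
  qed
  have "scaling (int n) =
      inv\<^bsub>fibre_affine\<^esub> (shift (int n)) \<otimes>\<^bsub>fibre_affine\<^esub> (scaling 0 \<otimes>\<^bsub>fibre_affine\<^esub> shift (int n))"
    by (simp add: scaling_def shift_def)
  moreover have "scaling 0 \<in> linear_part"
    by (simp add: generate.incl)
  ultimately show ?thesis
    using linear_part_subgroup shift[of n] subgroup.m_inv_closed
    by (auto intro!: generate.eng)
qed

text \<open>Translations of the line \<open>0\<close> fix the other lines, so conjugation by an element that preserves
  each line only sees its factor on the line \<open>0\<close>, and this factor can be made \<open>n\<close>.\<close>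

lemma translation_conj:
  assumes "0 < n"
  shows "\<exists>h\<in>linear_part. \<forall>q. translation (of_nat n * q) =
           h \<otimes>\<^bsub>fibre_affine\<^esub> translation q \<otimes>\<^bsub>fibre_affine\<^esub> inv\<^bsub>fibre_affine\<^esub> h"
proof -
  obtain k where n: "n = Suc k"
    using assms gr0_implies_Suc by blast
  have "translation (of_nat n * q) =
      scaling (int k) \<otimes>\<^bsub>fibre_affine\<^esub> translation q \<otimes>\<^bsub>fibre_affine\<^esub>
      inv\<^bsub>fibre_affine\<^esub> (scaling (int k))" for q
    by (simp add: n translation_def scaling_def fun_eq_iff)
  then show ?thesis
    using scaling_in_linear_part by blast
qed

text \<open>The left-hand side is the translation by \<open>m - n = \<bar>m - n\<bar> * c\<close> with \<open>c\<close> the sign of \<open>m - n\<close>, so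
  for \<open>m \<noteq> n\<close> it is conjugate to \<open>translation c\<close> by lemma \<open>translation_conj\<close>.\<close>

lemma translation_difference:
  "\<exists>h\<in>linear_part. \<exists>c\<in>{-1, 0, 1}.
     inv\<^bsub>fibre_affine\<^esub> (translation (of_nat n)) \<otimes>\<^bsub>fibre_affine\<^esub> translation (of_nat m) =
     h \<otimes>\<^bsub>fibre_affine\<^esub> translation c \<otimes>\<^bsub>fibre_affine\<^esub> inv\<^bsub>fibre_affine\<^esub> h"
proof -
  have *: "inv\<^bsub>fibre_affine\<^esub> (translation (of_nat n)) \<otimes>\<^bsub>fibre_affine\<^esub> translation (of_nat m) =
      translation (of_nat m - of_nat n)"
    by (simp add: inv_translation mult_translation)
  consider "n < m" | "m < n" | "n = m" by linarith
  then show ?thesis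
  proof cases
    case 1
    then show ?thesis
      using translation_conj[of "m - n"] unfolding *
      by (metis insertCI less_imp_le mult.right_neutral of_nat_diff zero_less_diff)
  next
    case 2
    then have "of_nat (n - m) * (-1) = (of_nat m - of_nat n :: rat)"
      by (simp add: of_nat_diff)
    then show ?thesis
      using 2 translation_conj[of "n - m"] unfolding *
      by (metis insertCI zero_less_diff)
  next
    case 3
    then have "inv\<^bsub>fibre_affine\<^esub> (translation (of_nat n)) \<otimes>\<^bsub>fibre_affine\<^esub> translation (of_nat m) =
        \<one>\<^bsub>fibre_affine\<^esub> \<otimes>\<^bsub>fibre_affine\<^esub> translation 0 \<otimes>\<^bsub>fibre_affine\<^esub> inv\<^bsub>fibre_affine\<^esub> \<one>\<^bsub>fibre_affine\<^esub>"
      unfolding * by (simp only: translation_0 W.inv_one W.r_one W.one_closed diff_self)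
    then show ?thesis
      using generate.one by blast
  qed
qed

lemma translation_in_generated:
  "translation (of_nat n) \<in> generate fibre_affine {shift 1, scaling 0, translation 1}"
proof (induction n)
  case 0
  then show ?case by (metis generate.one of_nat_0 translation_0)
next
  case (Suc n)
  have "translation (of_nat (Suc n)) = translation (of_nat n) \<otimes>\<^bsub>fibre_affine\<^esub> translation 1"
    by (simp add: mult_translation add.commute)
  then show ?case
    using Suc generate.eng generate.incl[of "translation 1" "{shift 1, scaling 0, translation 1}"] by fastforce
qed

text \<open>The second derived subgroup contains the commutator of a map scaling the line \<open>0\<close> with a
  translation of that line.\<close>

lemma derived2_nontrivial:
  fixes K defines "K \<equiv> generate fibre_affine {shift 1, scaling 0, translation 1}"
  shows "\<not> (derived fibre_affine ^^ 2) K \<subseteq> {\<one>\<^bsub>fibre_affine\<^esub>}"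
proof
  let ?com = "\<lambda>x y. x \<otimes>\<^bsub>fibre_affine\<^esub> y \<otimes>\<^bsub>fibre_affine\<^esub> inv\<^bsub>fibre_affine\<^esub> x \<otimes>\<^bsub>fibre_affine\<^esub> inv\<^bsub>fibre_affine\<^esub> y"
  have com: "?com x y \<in> derived fibre_affine S" if "x \<in> S" "y \<in> S" for x y S
    using that unfolding derived_def by (intro generate.incl) blast
  \<comment> \<open>\<open>u\<close> scales the line \<open>0\<close> by \<open>1/2\<close>, the quotient of the factors of the lines \<open>0\<close> and \<open>-1\<close>. As
    \<open>scaling 1\<close> doubles the line \<open>0\<close>, \<open>v\<close> translates it by \<open>2 - 1 = 1\<close>.\<close>
  define u where "u = ?com (scaling 0) (shift 1)"
  define v where "v = ?com (scaling 1) (translation 1)"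
  have "linear_part \<subseteq> K"
    unfolding K_def by (rule W.mono_generate) auto
  then have K: "scaling 0 \<in> K" "scaling 1 \<in> K" "shift 1 \<in> K" "translation 1 \<in> K"
    using scaling_in_linear_part[of 1] by (auto simp: K_def intro: generate.incl)
  then have "?com u v \<in> derived fibre_affine (derived fibre_affine K)"
    unfolding u_def v_def by (intro com)
  moreover assume "(derived fibre_affine ^^ 2) K \<subseteq> {\<one>\<^bsub>fibre_affine\<^esub>}"
  ultimately have "?com u v = \<one>\<^bsub>fibre_affine\<^esub>" by (auto simp: eval_nat_numeral)
  moreover have "v = translation 1"
    by (simp add: v_def scaling_def translation_def fun_eq_iff)
  moreover have "?com u (translation 1) = translation (- 1 / 2)"
    by (simp add: u_def scaling_def shift_def translation_def fun_eq_iff)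
  ultimately show False
    by (simp add: translation_def fun_eq_iff split: if_splits)
qed

section \<open>A finitely generated subgroup without bounded packing\<close>

theorem proposition5p1:
  shows "\<exists>(G :: nat monoid) H.
    group G \<and> finitely_generated G (carrier G) \<and>
    solvable G \<and> derived_length G = 3 \<and>
    subgroup H G \<and> finitely_generated G H \<and>
    \<not> bounded_packing G H"
proof -
  let ?S = "{shift 1, scaling 0, translation 1}" and ?W = fibre_affine
  obtain G :: "nat monoid" and \<psi> where hom: "group_hom G ?W \<psi>"
    and inj: "inj_on \<psi> (carrier G)" and img: "\<psi> ` carrier G = generate ?W ?S"
    by (rule W.generate_embeds_in_nat[of ?S]) auto
  interpret group_hom G ?W \<psi> by (fact hom)
  have eqI: "x = y" if "\<psi> x = \<psi> y" "x \<in> carrier G" "y \<in> carrier G" for x y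
    using that inj by (auto dest: inj_onD)
  have "?S \<subseteq> \<psi> ` carrier G"
    unfolding img by (auto intro: generate.incl)
  then obtain t a f where tS: "t \<in> carrier G" "a \<in> carrier G" "f \<in> carrier G"
    and \<psi>S: "\<psi> t = shift 1" "\<psi> a = scaling 0" "\<psi> f = translation 1"
    by (auto simp: image_iff)
  define H where "H = generate G {t, a}"
  have H: "subgroup H G"
    unfolding H_def using tS by (simp add: G.generate_is_subgroup)
  have \<psi>H: "\<psi> ` H = linear_part"
    unfolding H_def using generate_img[of "{t, a}"] tS \<psi>S by simp
  have "\<psi> ` generate G {t, a, f} = \<psi> ` carrier G"
    using generate_img[of "{t, a, f}"] tS \<psi>S img by simp
  then have gen: "generate G {t, a, f} = carrier G"
    using inj_on_image_eq_iff[OF inj] G.generate_incl[of "{t, a, f}"] tS by auto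
  have derived: "\<psi> ` (derived G ^^ n) (carrier G) = (derived ?W ^^ n) (generate ?W ?S)" for n
    using exp_of_derived_img[of "carrier G" n] img by simp
  have derived3: "(derived G ^^ 3) (carrier G) = {\<one>\<^bsub>G\<^esub>}"
  proof -
    have D: "subgroup ((derived G ^^ 3) (carrier G)) G"
      by (intro G.exp_of_derived_is_subgroup G.subgroup_self)
    have "(derived ?W ^^ 3) (generate ?W ?S) \<subseteq> (derived ?W ^^ 3) (carrier ?W)"
      by (intro W.mono_exp_of_derived W.generate_incl) simp
    then have "\<psi> x = \<psi> \<one>\<^bsub>G\<^esub>" if "x \<in> (derived G ^^ 3) (carrier G)" for x
      using that derived[of 3] derived3_fibre_affine by auto
    then show ?thesis
      using subgroup.subset[OF D] subgroup.one_closed[OF D] by (blast intro: eqI)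
  qed
  have "\<not> (derived G ^^ 2) (carrier G) \<subseteq> {\<one>\<^bsub>G\<^esub>}"
  proof
    assume "(derived G ^^ 2) (carrier G) \<subseteq> {\<one>\<^bsub>G\<^esub>}"
    then have "\<psi> ` (derived G ^^ 2) (carrier G) \<subseteq> {\<psi> \<one>\<^bsub>G\<^esub>}" by blast
    then show False using derived2_nontrivial by (simp only: derived hom_one)
  qed
  then have length: "derived_length G = 3"
    using G.derived_length_eq_Suc[of 2] derived3 by (simp add: numeral_3_eq_3 numeral_2_eq_2)
  have "solvable G"
    using derived3 G.solvable_iff_trivial_derived_seq by blast
  \<comment> \<open>The powers of \<open>f\<close>, and representatives of the double cosets containing their differences.\<close>
  let ?X = "{x \<in> carrier G. \<exists>n. \<psi> x = translation (of_nat n)}"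
  let ?F = "{x \<in> carrier G. \<exists>c\<in>{-1, 0, 1}. \<psi> x = translation c}"
  have "\<not> bounded_packing G H"
  proof (rule G.not_bounded_packing_if_differences_in_finite_double_cosets[of H ?F ?X])
    have "?F = \<psi> -` (translation ` {-1, 0, 1}) \<inter> carrier G" by blast
    then show "finite ?F"
      using finite_vimage_IntI[OF _ inj, of "translation ` {-1, 0, 1}"] by simp
  next
    have "translation (of_nat n) \<in> \<psi> ` ?X" for n
    proof -
      have "translation (of_nat n) \<in> \<psi> ` carrier G"
        unfolding img by (rule translation_in_generated)
      then obtain x where "translation (of_nat n) = \<psi> x" "x \<in> carrier G" by (rule imageE)
      then show ?thesis by (intro image_eqI[of _ _ x] CollectI conjI exI[of _ n]) simp_all
    qed
    then have "range (\<lambda>n. translation (of_nat n)) \<subseteq> \<psi> ` ?X" by (intro image_subsetI)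
    moreover have "inj (\<lambda>n. translation (of_nat n))"
      by (auto simp: inj_def translation_eq_iff)
    ultimately show "infinite ?X"
      by (meson finite_imageI finite_imageD finite_subset infinite_UNIV_nat)
  next
    fix x y assume x: "x \<in> ?X" and y: "y \<in> ?X"
    then obtain n m where xy: "x \<in> carrier G" "y \<in> carrier G"
      and n: "\<psi> x = translation (of_nat n)" and m: "\<psi> y = translation (of_nat m)"
      by blast
    have diff: "\<psi> (inv\<^bsub>G\<^esub> x \<otimes>\<^bsub>G\<^esub> y) = inv\<^bsub>?W\<^esub> (translation (of_nat n)) \<otimes>\<^bsub>?W\<^esub> translation (of_nat m)"
      using xy n m by simp
    show "x = y" if "inv\<^bsub>G\<^esub> x \<otimes>\<^bsub>G\<^esub> y \<in> H"
    proof -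
      have "\<psi> (inv\<^bsub>G\<^esub> x \<otimes>\<^bsub>G\<^esub> y) \<in> linear_part"
        using that \<psi>H by blast
      then have "translation (of_nat m - of_nat n) \<in> linear_part"
        by (simp only: diff inv_translation mult_translation uminus_add_conv_diff)
      then have "n = m" by (simp add: translation_in_linear_part_iff)
      then show "x = y" using n m xy by (auto intro: eqI)
    qed
    obtain w c where w: "w \<in> linear_part" and c: "c \<in> {-1, 0, 1}"
      and wc: "\<psi> (inv\<^bsub>G\<^esub> x \<otimes>\<^bsub>G\<^esub> y) = w \<otimes>\<^bsub>?W\<^esub> translation c \<otimes>\<^bsub>?W\<^esub> inv\<^bsub>?W\<^esub> w"
      using translation_difference[of n m] unfolding diff by blast
    obtain h where h: "h \<in> H" "\<psi> h = w"
      using w unfolding \<psi>H[symmetric] by auto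
    obtain k where k: "k \<in> ?F" "\<psi> k = translation c"
    proof -
      have "\<psi> (inv\<^bsub>G\<^esub> f) = translation (- 1)" "\<psi> \<one>\<^bsub>G\<^esub> = translation 0"
        using tS \<psi>S by (simp_all add: inv_translation translation_0 del: fibre_affine_simps)
      then have "\<exists>k\<in>carrier G. \<psi> k = translation c"
        using c tS \<psi>S by (metis G.inv_closed G.one_closed empty_iff insert_iff)
      then show ?thesis
        using c that by blast
    qed
    have "inv\<^bsub>G\<^esub> x \<otimes>\<^bsub>G\<^esub> y = h \<otimes>\<^bsub>G\<^esub> k \<otimes>\<^bsub>G\<^esub> inv\<^bsub>G\<^esub> h"
      using h k xy subgroup.subset[OF H] wc by (intro eqI) auto
    then show "\<exists>h\<in>H. \<exists>c\<in>?F. \<exists>h'\<in>H. inv\<^bsub>G\<^esub> x \<otimes>\<^bsub>G\<^esub> y = h \<otimes>\<^bsub>G\<^esub> c \<otimes>\<^bsub>G\<^esub> h'"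
      using h k subgroup.m_inv_closed[OF H] by blast
  qed (use H in auto)
  moreover have "finitely_generated G (carrier G)"
    unfolding finitely_generated_def using gen tS by (intro exI[of _ "{t, a, f}"]) auto
  moreover have "finitely_generated G H"
    unfolding finitely_generated_def H_def
    by (intro exI[of _ "{t, a}"]) (auto intro: generate.incl)
  ultimately show ?thesis
    using H length \<open>solvable G\<close> G.group_axioms by blast
qed

end
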